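(* For every $n\ge 3$, the arc set $D_n$ defined in the context is a cycle cover of size two of the directed $\sigma$-$\tau$ graph $\Gamma_n$: every vertex has exactly one arc of $D_n$ entering it and exactly one leaving it, and $D_n$ is the union of the arc sets of exactly two vertex-disjoint directed cycles which together cover all vertices.
   Context: A permutation of $\{1,\dots,n\}$ is written as a string $\mathbf{p}=p_0p_1\cdots p_{n-1}$ in which each symbol appears once. $\mathbf{p}\sigma = p_1p_2\cdots p_{n-1}p_0$, $\mathbf{p}\sigma^{-1}=p_{n-1}p_0\cdots p_{n-2}$, $\mathbf{p}\tau = p_1p_0p_2\cdots p_{n-1}$. The directed $\sigma$-$\tau$ graph $\Gamma_n$ has the $n!$ permutation strings as vertices and arcs $(\mathbf{p},\mathbf{p}\sigma)$ ($\sigma$-arcs) and $(\mathbf{p},\mathbf{p}\tau)$ ($\tau$-arcs). Definition of $D_n$: for each vertex $\mathbf{p}$, let $i$ be the index with $p_i=n$ and $r=p_{(i\bmod n-1)+1}$. Then $(\mathbf{p}\tau,\mathbf{p})\in D_n$ if (a) $r<n-1$ and $r=p_0-1$, or (b) $r=n-1$ and $p_0=1$; otherwise $(\mathbf{p}\sigma^{-1},\mathbf{p})\in D_n$. No other arcs are in $D_n$. *)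

theory Defs
  imports "HOL-Combinatorics.Multiset_Permutations" "Graph_Theory.Pair_Digraph"
begin

abbreviation perm_strings :: "nat \<Rightarrow> nat list set" where
  "perm_strings n \<equiv> permutations_of_set {1..n}"

definition sigma :: "'a list \<Rightarrow> 'a list" where
  "sigma p = tl p @ [hd p]"

definition sigma_inv :: "'a list \<Rightarrow> 'a list" where
  "sigma_inv p = last p # butlast p"

(* Only lists with at least two entries matter; shorter ones are left unchanged. *)
fun tau :: "'a list \<Rightarrow> 'a list" where
  "tau (x # y # zs) = y # x # zs"
| "tau p = p"

definition sigma_tau_graph :: "nat \<Rightarrow> nat list pair_pre_digraph" where
  "sigma_tau_graph n =
    \<lparr> pverts = perm_strings n,
      parcs = {(p, sigma p) | p. p \<in> perm_strings n} \<union> {(p, tau p) | p. p \<in> perm_strings n} \<rparr>"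

definition index_of :: "'a list \<Rightarrow> 'a \<Rightarrow> nat" where
  "index_of p x = (THE i. i < length p \<and> p ! i = x)"

(* The symbol r: the one following n, where the last position is followed by
   position 1 rather than position 0. *)
definition succ_symbol :: "nat \<Rightarrow> nat list \<Rightarrow> nat" where
  "succ_symbol n p = p ! (index_of p n mod (n - 1) + 1)"

(* r + 1 = p ! 0 renders r = p_0 - 1 without truncated subtraction. *)
definition tau_condition :: "nat \<Rightarrow> nat list \<Rightarrow> bool" where
  "tau_condition n p \<longleftrightarrow>
    (let r = succ_symbol n p in
      r < n - 1 \<and> r + 1 = p ! 0 \<or> r = n - 1 \<and> p ! 0 = 1)"

definition D :: "nat \<Rightarrow> nat list rel" where
  "D n = {(if tau_condition n p then tau p else sigma_inv p, p) | p. p \<in> perm_strings n}"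

(* In a closed walk every vertex is the tail of some arc of the walk. *)
definition cycle_verts :: "('a \<times> 'a) awalk \<Rightarrow> 'a set" where
  "cycle_verts c = fst ` set c"

end

(* The arcs of D_n reverse a permutation prd of the vertices: prd rotates a string by sigma^-1 except
   at the heads of tau-arcs. Without the tau-arcs one would get one cycle per cyclic string of the n
   symbols. For each cyclic string of n - 1 symbols with r after n and x = r + 1 missing (modulo
   n - 1), the tau-arcs splice together the n - 1 cyclic strings obtained by inserting x. Recording a
   cyclic string by the word a read after n, the splicing defines a graph in which every a has a
   parent x a', where x = hd a + 1 and a' is a without x. The parent continues a longer descending
   run r, r - 1, ..., so the graph consists of trees hanging off the n - 1 fully descending words,
   and these form a single closed chain. Each tree is spliced into one piece, by induction from the
   leaves, whereas the closed chain has an inner and an outer side: the inner one is an explicit cycle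
   of length 2 (n - 1), the outer one contains everything else. *)

theory Submission
  imports Defs "HOL-Combinatorics.Orbits"
begin

section \<open>Orbits as directed cycles\<close>

text \<open>The arcs point against \<open>f\<close>, so the walk runs through decreasing powers,
  from \<open>(f ^^ m) p = p\<close> down to \<open>p\<close>.\<close>

lemma cycle_of_orbit:
  fixes G :: "'a pair_pre_digraph"
  assumes "permutation f" and verts: "orbit f p \<subseteq> pverts G"
    and arcs: "\<And>q. q \<in> orbit f p \<Longrightarrow> (f q, q) \<in> parcs G"
  obtains c where "pre_digraph.cycle (with_proj G) c" "set c = {(f q, q) | q. q \<in> orbit f p}"
proof -
  define m where "m = funpow_dist1 f p p"
  define walk where
    "walk k = map (\<lambda>i. ((f ^^ Suc i) p, (f ^^ i) p)) (rev [0..<k])" for k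
  have self: "p \<in> orbit f p"
    using assms(1) by (rule permutation_self_in_orbit)
  have orb: "orbit f p = (\<lambda>i. (f ^^ i) p) ` {0..<m}"
    using orbit_conv_funpow_dist1[OF self] by (simp add: m_def)
  have loop: "(f ^^ m) p = p"
    using funpow_dist1_prop[OF self] by (simp add: m_def)
  have inj: "inj_on (\<lambda>i. (f ^^ i) p) {0..<m}"
    using inj_on_funpow_dist1[OF self] by (simp add: m_def)
  have cas: "pcas ((f ^^ k) p) (walk k) p" for k
    by (induction k) (auto simp: walk_def)
  have awverts: "pawalk_verts ((f ^^ k) p) (walk k) = map (\<lambda>i. (f ^^ i) p) (rev [0..<Suc k])" for k
    by (induction k) (auto simp: walk_def)
  have set_walk: "set (walk m) = {(f q, q) | q. q \<in> orbit f p}"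
    by (auto simp: walk_def orb)
  have "pre_digraph.cycle (with_proj G) (walk m)"
    unfolding pre_digraph.cycle_def pre_digraph.awalk_def cas_with_proj_eq awalk_verts_with_proj_eq
  proof (intro exI[of _ p] conjI)
    show "p \<in> verts (with_proj G)"
      using self verts by auto
    show "set (walk m) \<subseteq> Digraph.arcs (with_proj G)"
      using arcs by (auto simp: set_walk)
    show "pcas p (walk m) p"
      using cas[of m] by (simp add: loop)
    \<comment> \<open>\<open>tl\<close> drops the repeated vertex \<open>(f ^^ m) p = p\<close>; the
      exponents below \<open>m\<close> give distinct vertices.\<close>
    have "tl (pawalk_verts p (walk m)) = map (\<lambda>i. (f ^^ i) p) (rev [0..<m])"
      using awverts[of m] by (simp add: loop)
    then show "distinct (tl (pawalk_verts p (walk m)))"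
      using inj by (simp add: distinct_map)
    show "walk m \<noteq> []"
      by (simp add: walk_def m_def)
  qed
  with set_walk show ?thesis
    using that by blast
qed

section \<open>The predecessor map\<close>

lemma sigma_inv_snoc [simp]: "sigma_inv (xs @ [x]) = x # xs"
  by (simp add: sigma_inv_def)

lemma sigma_Cons [simp]: "sigma (x # xs) = xs @ [x]"
  by (simp add: sigma_def)

lemma tau_tau [simp]: "tau (tau p) = p"
  by (cases p rule: tau.cases) auto

lemma sigma_sigma_inv [simp]: "p \<noteq> [] \<Longrightarrow> sigma (sigma_inv p) = p"
  by (cases p rule: rev_cases) auto

lemma sigma_inv_sigma [simp]: "p \<noteq> [] \<Longrightarrow> sigma_inv (sigma p) = p"
  by (cases p) auto

lemma set_tau [simp]: "set (tau p) = set p"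
  by (cases p rule: tau.cases) auto

lemma distinct_tau [simp]: "distinct (tau p) = distinct p"
  by (cases p rule: tau.cases) auto

lemma in_permutations_of_set_iff: "p \<in> permutations_of_set A \<longleftrightarrow> distinct p \<and> set p = A"
  by (auto simp: permutations_of_set_def)

lemma tau_perm_strings [simp]: "tau p \<in> permutations_of_set A \<longleftrightarrow> p \<in> permutations_of_set A"
  by (simp add: in_permutations_of_set_iff)

lemma length_perm_string: "p \<in> perm_strings n \<Longrightarrow> length p = n"
  by (drule length_finite_permutations_of_set) simp

lemma sigma_inv_perm_strings:
  "p \<noteq> [] \<Longrightarrow> p \<in> permutations_of_set A \<Longrightarrow> sigma_inv p \<in> permutations_of_set A"
  by (cases p rule: rev_cases) (auto simp: in_permutations_of_set_iff)

lemma sigma_perm_strings: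
  "p \<noteq> [] \<Longrightarrow> p \<in> permutations_of_set A \<Longrightarrow> sigma p \<in> permutations_of_set A"
  by (cases p) (auto simp: in_permutations_of_set_iff)

lemma index_of_eq:
  assumes "distinct (xs @ x # ys)"
  shows "index_of (xs @ x # ys) x = length xs"
  unfolding index_of_def
proof (rule the_equality)
  fix i
  assume "i < length (xs @ x # ys) \<and> (xs @ x # ys) ! i = x"
  then show "i = length xs"
    using assms nth_eq_iff_index_eq[OF assms, of i "length xs"] by simp
qed simp

lemma funpow_funpow: "(f ^^ i) ((f ^^ j) x) = (f ^^ (i + j)) x"
  by (simp add: funpow_add)

locale sigma_tau =
  fixes n :: nat
  assumes n_ge_3: "n \<ge> 3"
begin

definition nxt :: "nat \<Rightarrow> nat" where
  "nxt x = x mod (n - 1) + 1"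

lemma tau_condition_n_first: "\<not> tau_condition n (n # p)"
  using n_ge_3 by (auto simp: tau_condition_def Let_def)

text \<open>The index rule skips position 0, so \<open>r\<close> follows \<open>n\<close> in the
  cyclic string left after deleting the front symbol \<open>x\<close>. The two clauses merge into a
  successor modulo \<open>n - 1\<close>.\<close>

lemma tau_condition_iff:
  assumes p: "x # u @ n # v \<in> perm_strings n"
  shows "tau_condition n (x # u @ n # v) \<longleftrightarrow> x = nxt (hd (v @ u))"
proof -
  have dist: "distinct ((x # u) @ n # v)" and set: "set (x # u @ n # v) = {1..n}"
    using p by (simp_all add: in_permutations_of_set_iff)
  have "length (x # u @ n # v) = n"
    using p by (rule length_perm_string)
  then have len: "length u + length v + 2 = n"
    by simp
  then have ne: "v @ u \<noteq> []"
    using n_ge_3 by auto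
  have ind: "index_of (x # u @ n # v) n = length u + 1"
    using index_of_eq[OF dist] by simp
  have succ: "succ_symbol n (x # u @ n # v) = hd (v @ u)"
  proof (cases v)
    case Nil
    \<comment> \<open>\<open>n\<close> stands last, and its index is 0 modulo \<open>n - 1\<close>,
      so the symbol read is at position 1.\<close>
    then have "length u + 1 = n - 1"
      using len by simp
    then have "succ_symbol n (x # u @ n # v) = (x # u @ n # v) ! 1"
      unfolding succ_symbol_def ind by simp
    then show ?thesis
      using Nil ne by (auto simp: nth_append hd_conv_nth)
  next
    case (Cons y v')
    then have "length u + 1 < n - 1"
      using len by simp
    then show ?thesis
      unfolding succ_symbol_def ind using Cons by (simp add: nth_append)
  qed
  have "hd (v @ u) \<in> set (v @ u)"
    using ne by (rule hd_in_set)
  moreover have "set (v @ u) \<subseteq> {1..n} - {n}"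
    using dist set by auto
  ultimately have "hd (v @ u) \<in> {1..n} - {n}"
    by blast
  then have "1 \<le> hd (v @ u)" "hd (v @ u) \<le> n - 1"
    by auto
  then show ?thesis
    unfolding tau_condition_def succ Let_def nxt_def
    using n_ge_3 by (cases "hd (v @ u) = n - 1") auto
qed

text \<open>\<open>sigma q\<close> and \<open>tau q\<close> have the same front symbol, and deleting
  it leaves the same cyclic string; the condition depends on nothing else.\<close>

lemma tau_condition_sigma_tau:
  assumes q: "q \<in> perm_strings n" and "tau_condition n (sigma q)"
  shows "tau_condition n (tau q)"
proof -
  have "length q = n"
    using q by (rule length_perm_string)
  then obtain y x w where q_eq: "q = y # x # w" and "w \<noteq> []"
    using n_ge_3 by (cases q rule: tau.cases) fastforce+
  have sq: "sigma q \<in> perm_strings n"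
    using q q_eq sigma_perm_strings[of q "{1..n}"] by simp
  have tq: "tau q \<in> perm_strings n"
    using q by simp
  have "x \<noteq> n"
    using assms(2) q_eq tau_condition_n_first by auto
  moreover have "n \<in> set q"
    using q n_ge_3 by (simp add: in_permutations_of_set_iff)
  ultimately consider "y = n" | u v where "w = u @ n # v"
    by (auto simp: q_eq in_set_conv_decomp)
  then show ?thesis
  proof cases
    case 1
    have "sigma q = x # w @ n # []" "tau q = x # [] @ n # w"
      by (simp_all add: q_eq 1)
    then show ?thesis
      using assms(2) tau_condition_iff[of x w "[]"] tau_condition_iff[of x "[]" w]
        sq tq by simp
  next
    case 2
    have "sigma q = x # u @ n # (v @ [y])" "tau q = x # (y # u) @ n # v"
      by (simp_all add: q_eq 2)
    then show ?thesis
      using assms(2) tau_condition_iff[of x u "v @ [y]"] tau_condition_iff[of x "y # u" v]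
        sq tq by (cases v) simp_all
  qed
qed

lemma perm_string_nonempty: "p \<in> perm_strings n \<Longrightarrow> p \<noteq> []"
  using n_ge_3 length_perm_string[of p n] by auto

text \<open>Extended by the identity outside the vertex set, as \<open>permutes\<close>
  demands.\<close>

definition prd :: "nat list \<Rightarrow> nat list" where
  "prd p = (if p \<in> perm_strings n then if tau_condition n p then tau p else sigma_inv p else p)"

text \<open>Each \<open>q\<close> is the image of \<open>tau q\<close> if the condition holds at
  \<open>sigma q\<close>, and of \<open>sigma q\<close> otherwise. Surjectivity suffices on a finite
  set.\<close>

lemma prd_permutes: "prd permutes perm_strings n"
proof (rule bij_imp_permutes)
  have "perm_strings n \<subseteq> prd ` perm_strings n"
  proof
    fix q assume q: "q \<in> perm_strings n"
    show "q \<in> prd ` perm_strings n"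
    proof (cases "tau_condition n (sigma q)")
      case True
      then show ?thesis
        using q tau_condition_sigma_tau by (intro image_eqI[of _ _ "tau q"]) (simp_all add: prd_def)
    next
      case False
      moreover have "sigma q \<in> perm_strings n" "q \<noteq> []"
        using q perm_string_nonempty sigma_perm_strings by blast+
      ultimately show ?thesis
        by (intro image_eqI[of _ _ "sigma q"]) (simp_all add: prd_def)
    qed
  qed
  moreover have "prd ` perm_strings n \<subseteq> perm_strings n"
    using perm_string_nonempty by (auto simp: prd_def sigma_inv_perm_strings)
  ultimately show "bij_betw prd (perm_strings n) (perm_strings n)"
    unfolding bij_betw_def using finite_surj_inj[OF finite_permutations_of_set] by blast
qed (simp add: prd_def)

lemma prd_permutation: "permutation prd"
  unfolding permutation_permutes using prd_permutes finite_permutations_of_set by blast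

section \<open>The arc set as a cycle cover\<close>

lemma D_eq: "D n = {(prd p, p) | p. p \<in> perm_strings n}"
  by (auto simp: D_def prd_def)

lemma D_subset: "D n \<subseteq> parcs (sigma_tau_graph n)"
proof
  fix a assume "a \<in> D n"
  then obtain p where p: "a = (prd p, p)" "p \<in> perm_strings n"
    by (auto simp: D_eq)
  have "p \<noteq> []"
    using p perm_string_nonempty by blast
  show "a \<in> parcs (sigma_tau_graph n)"
  proof (cases "tau_condition n p")
    case True
    then have "a = (tau p, tau (tau p))" "tau p \<in> perm_strings n"
      using p by (simp_all add: prd_def)
    then show ?thesis
      unfolding sigma_tau_graph_def by auto
  next
    case False
    then have "a = (sigma_inv p, sigma (sigma_inv p))" "sigma_inv p \<in> perm_strings n"
      using p \<open>p \<noteq> []\<close> by (simp_all add: prd_def sigma_inv_perm_strings)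
    then show ?thesis
      unfolding sigma_tau_graph_def by auto
  qed
qed

lemma D_cover:
  assumes "v \<in> perm_strings n"
  shows "(\<exists>!a. a \<in> D n \<and> snd a = v) \<and> (\<exists>!a. a \<in> D n \<and> fst a = v)"
proof
  show "\<exists>!a. a \<in> D n \<and> snd a = v"
    using assms by (auto simp: D_eq)
  obtain p where p: "prd p = v"
    using permutes_surj[OF prd_permutes] by (metis surjD)
  with assms have "p \<in> perm_strings n"
    using permutes_in_image[OF prd_permutes, of p] by simp
  moreover have "inj prd"
    using prd_permutes by (rule permutes_inj)
  ultimately show "\<exists>!a. a \<in> D n \<and> fst a = v"
    using p by (intro ex1I[of _ "(v, p)"]) (auto simp: D_eq inj_eq)
qed


section \<open>Cyclic strings\<close>

lemma nxt_in: "nxt x \<in> {1..<n}"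
proof -
  have "x mod (n - 1) < n - 1"
    using n_ge_3 by simp
  then show ?thesis
    by (auto simp: nxt_def)
qed

lemma funpow_nxt:
  assumes "x \<in> {1..<n}"
  shows "(nxt ^^ k) x = (x - 1 + k) mod (n - 1) + 1"
proof (induction k)
  case 0
  then show ?case
    using assms by auto
next
  case (Suc k)
  have "(nxt ^^ Suc k) x = ((x - 1 + k) mod (n - 1) + 1) mod (n - 1) + 1"
    by (simp only: funpow.simps o_apply Suc nxt_def)
  also have "\<dots> = (x - 1 + Suc k) mod (n - 1) + 1"
    by (simp add: mod_simps)
  finally show ?case .
qed

lemma funpow_nxt_in: "x \<in> {1..<n} \<Longrightarrow> (nxt ^^ k) x \<in> {1..<n}"
  using nxt_in by (induction k) auto

lemma funpow_nxt_period: "x \<in> {1..<n} \<Longrightarrow> (nxt ^^ (n - 1)) x = x"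
proof (subst funpow_nxt)
  assume "x \<in> {1..<n}"
  then show "(x - 1 + (n - 1)) mod (n - 1) + 1 = x"
    by (simp only: mod_add_self2) auto
qed

lemma funpow_nxt_neq:
  assumes "x \<in> {1..<n}" "0 < k" "k < n - 1"
  shows "(nxt ^^ k) x \<noteq> x"
proof
  assume "(nxt ^^ k) x = x"
  then have "(x - 1 + k) mod (n - 1) = x - 1"
    using assms(1) by (auto simp: funpow_nxt)
  moreover have "x - 1 < n - 1"
    using assms by auto
  ultimately show False
    using assms(2,3) by (cases "x - 1 + k < n - 1") (auto simp: le_mod_geq)
qed

lemma nxt_neq: "x \<in> {1..<n} \<Longrightarrow> nxt x \<noteq> x"
  using funpow_nxt_neq[of x 1] n_ge_3 by simp

text \<open>Iterating \<open>nxt\<close> from 1 reaches every symbol. This serves to walk along the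
  closed chain of descending words.\<close>

lemma nxt_induct [consumes 1, case_names one nxt]:
  assumes "x \<in> {1..<n}" "P 1" "\<And>x. x \<in> {1..<n} \<Longrightarrow> P x \<Longrightarrow> P (nxt x)"
  shows "P x"
proof -
  have "P ((nxt ^^ k) 1)" for k
    using assms(2,3) funpow_nxt_in[of 1] n_ge_3 by (induction k) auto
  moreover have "(nxt ^^ (x - 1)) 1 = x"
    using assms(1) n_ge_3 by (subst funpow_nxt) auto
  ultimately show ?thesis
    by metis
qed

text \<open>A cyclic string of all \<open>n\<close> symbols is recorded by its reading \<open>a\<close> after the symbol
  \<open>n\<close>; the strings on it are \<open>v @ n # u\<close> for \<open>a = u @ v\<close>.\<close>

abbreviation necklaces :: "nat list set" where
  "necklaces \<equiv> permutations_of_set {1..<n}"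

lemma necklace_rotation:
  assumes "u @ v \<in> necklaces"
  shows "v @ n # u \<in> perm_strings n"
proof -
  have "{1..n} = insert n {1..<n}"
    using n_ge_3 by auto
  with assms show ?thesis
    by (auto simp: in_permutations_of_set_iff)
qed

lemma perm_string_rotation:
  assumes "p \<in> perm_strings n"
  obtains u v where "p = v @ n # u" "u @ v \<in> necklaces"
proof -
  have "n \<in> set p"
    using assms n_ge_3 by (simp add: in_permutations_of_set_iff)
  then obtain u v where p: "p = v @ n # u"
    by (meson split_list)
  have "{1..<n} = {1..n} - {n}"
    by auto
  then have "u @ v \<in> necklaces"
    using assms unfolding p in_permutations_of_set_iff by auto
  with p show ?thesis
    using that by blast
qed

lemma length_necklace: "a \<in> necklaces \<Longrightarrow> length a = n - 1"
  by (drule length_finite_permutations_of_set) simp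

lemma prd_sigma_inv:
  assumes "u @ v \<in> necklaces" "u \<noteq> []" "v = [] \<or> hd v \<noteq> nxt (hd u)"
  shows "prd (v @ n # u) = sigma_inv (v @ n # u)"
proof (cases v)
  case Nil
  then show ?thesis
    using necklace_rotation[OF assms(1)] tau_condition_n_first by (simp add: prd_def)
next
  case (Cons x v')
  then show ?thesis
    using necklace_rotation[OF assms(1)] tau_condition_iff[of x v' u] assms(2,3)
    by (simp add: prd_def)
qed

text \<open>With \<open>n\<close> last, the front symbol \<open>x\<close> is skipped and the
  comparison is with the second symbol \<open>r\<close>.\<close>

lemma prd_sigma_inv_last:
  assumes "x # r # b \<in> necklaces" "x \<noteq> nxt r"
  shows "prd (x # r # b @ [n]) = n # x # r # b"
  using necklace_rotation[of "[]" "x # r # b"] tau_condition_iff[of x "r # b" "[]"] assms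
    sigma_inv_snoc[of "x # r # b" n]
  by (simp add: prd_def)

lemma prd_tau:
  assumes "v @ x # u \<in> necklaces" "x = nxt (hd (v @ u))"
  shows "prd (x # u @ n # v) = tau (x # u @ n # v)"
  using necklace_rotation[of v "x # u"] tau_condition_iff[of x u v] assms
  by (simp add: prd_def)

section \<open>Linked strings\<close>

text \<open>Equality of orbits instead of reachability makes this an equivalence relation at
  once.\<close>

definition linked :: "nat list \<Rightarrow> nat list \<Rightarrow> bool" where
  "linked p q \<longleftrightarrow> orbit prd p = orbit prd q"

lemma linked_refl [simp]: "linked p p"
  by (simp add: linked_def)

lemma linked_sym: "linked p q \<Longrightarrow> linked q p"
  by (simp add: linked_def)

lemma linked_trans [trans]: "linked p q \<Longrightarrow> linked q r \<Longrightarrow> linked p r"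
  by (simp add: linked_def)

lemma linked_prd: "linked p (prd p)"
  using permutation_orbit_step[OF prd_permutation] by (simp add: linked_def)

text \<open>The whole cyclic string recorded by \<open>a\<close> lies on one cycle of
  \<open>prd\<close>.\<close>

definition fused :: "nat list \<Rightarrow> bool" where
  "fused a \<longleftrightarrow> (\<forall>u v. u @ v = a \<longrightarrow> linked (v @ n # u) (n # a))"

lemma fusedD: "fused (u @ v) \<Longrightarrow> linked (v @ n # u) (n # u @ v)"
  by (auto simp: fused_def)

lemma fused_sigma_inv:
  assumes "fused (u @ v)"
  shows "linked (v @ n # u) (sigma_inv (v @ n # u))"
proof (cases u rule: rev_cases)
  case Nil
  then show ?thesis
    using assms fusedD[of "[]" v] by simp
next
  case (snoc w z)
  have "linked ((z # v) @ n # w) (n # u @ v)"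
    using assms fusedD[of w "z # v"] snoc by simp
  moreover have "sigma_inv (v @ n # u) = (z # v) @ n # w"
    using sigma_inv_snoc[of "v @ n # w" z] snoc by simp
  ultimately show ?thesis
    using fusedD[OF assms] by (simp add: linked_def)
qed

text \<open>The predecessor map rotates a cyclic string except at two places: the string starting with
  the cyclic successor of \<open>hd a\<close> and possibly \<open>a @ [n]\<close>. Opening a cycle at one place keeps it
  connected.\<close>

lemma fusedI:
  assumes a: "a \<in> necklaces" and last: "linked (a @ [n]) (n # a)"
  shows "fused a"
proof -
  define x where "x = nxt (hd a)"
  have "a \<noteq> []"
    using a n_ge_3 length_necklace by fastforce
  have dist: "distinct a" and set: "set a = {1..<n}"
    using a by (simp_all add: in_permutations_of_set_iff)
  \<comment> \<open>These strings, including the one that starts with \<open>x\<close>, are reached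
    from \<open>n # a\<close> by plain rotations.\<close>
  have short: "linked (v @ n # u) (n # a)" if "u @ v = a" "x \<notin> set (tl v)" for u v
    using that
  proof (induction v arbitrary: u)
    case (Cons z v)
    have "linked (v @ n # u @ [z]) (n # a)"
      using Cons by (cases v) auto
    moreover have "v = [] \<or> hd v \<noteq> x" "hd (u @ [z]) = hd a"
      using Cons.prems by (cases v; cases u; auto)+
    then have "prd (v @ n # u @ [z]) = sigma_inv (v @ n # u @ [z])"
      using Cons.prems a by (intro prd_sigma_inv) (simp_all add: x_def)
    then have "linked (v @ n # u @ [z]) (z # v @ n # u)"
      using linked_prd[of "v @ n # u @ [z]"] sigma_inv_snoc[of "v @ n # u" z] by simp
    ultimately show ?case
      by (simp add: linked_def)
  qed simp
  \<comment> \<open>The other strings rotate under \<open>prd\<close> until they reach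
    \<open>a @ [n]\<close>, where \<open>last\<close> leads over to \<open>n # a\<close>.\<close>
  have long: "linked (v @ n # u) (n # a)" if "u @ v = a" "x \<notin> set u" "hd v \<noteq> x" for u v
    using that
  proof (induction u arbitrary: v rule: rev_induct)
    case Nil
    then show ?case
      using last by simp
  next
    case (snoc z u)
    have "hd (u @ [z]) = hd a"
      using snoc.prems by (cases u) auto
    then have "prd (v @ n # u @ [z]) = sigma_inv (v @ n # u @ [z])"
      using snoc.prems a by (intro prd_sigma_inv) (simp_all add: x_def)
    then have "linked (v @ n # u @ [z]) (z # v @ n # u)"
      using linked_prd[of "v @ n # u @ [z]"] sigma_inv_snoc[of "v @ n # u" z] by simp
    also have "linked (z # v @ n # u) (n # a)"
      using snoc.IH[of "z # v"] snoc.prems by simp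
    finally show ?case .
  qed
  show ?thesis
    unfolding fused_def
  proof (intro allI impI)
    fix u v assume uv: "u @ v = a"
    have "x \<in> set a"
      using set nxt_in by (simp add: x_def)
    show "linked (v @ n # u) (n # a)"
    proof (cases "x \<in> set (tl v)")
      case True
      then obtain y w where "v = y # w" "x \<in> set w"
        by (cases v) auto
      moreover from this have "x \<notin> set u" "x \<noteq> y"
        using dist uv by auto
      ultimately show ?thesis
        using long[OF uv] by simp
    next
      case False
      then show ?thesis
        using short[OF uv] by blast
    qed
  qed
qed

text \<open>Fix a symbol \<open>r\<close> after \<open>n\<close> and move \<open>x = nxt r\<close> through the remaining symbols: the
  \<open>\<tau>\<close>-arcs connect the cyclic strings obtained in this way.\<close>

lemma linked_slide:
  assumes neck: "x # r # b \<in> necklaces" and x: "x = nxt r"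
    and fused: "\<And>u v. u @ v = b \<Longrightarrow> v \<noteq> [] \<Longrightarrow> fused (r # u @ x # v)"
    and "u @ v = b"
  shows "linked (x # r # b @ [n]) (sigma_inv (x # v @ n # r # u))"
  using \<open>u @ v = b\<close>
proof (induction u arbitrary: v rule: rev_induct)
  case Nil
  have "prd (x # r # b @ [n]) = r # x # b @ [n]"
    using prd_tau[of "[]" x "r # b"] neck x by simp
  moreover have "sigma_inv (x # v @ n # r # []) = r # x # b @ [n]"
    using Nil sigma_inv_snoc[of "x # b @ [n]" r] by simp
  ultimately show ?case
    using linked_prd[of "x # r # b @ [n]"] by simp
next
  case (snoc z u)
  have "linked (x # r # b @ [n]) (sigma_inv (x # (z # v) @ n # r # u))"
    using snoc.IH[of "z # v"] snoc.prems by simp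
  \<comment> \<open>Both are rotations of the fused cyclic string \<open>r # u @ x # z # v\<close>;
    this crosses the rotation that \<open>prd\<close> omits.\<close>
  also have "linked \<dots> (x # (z # v) @ n # r # u)"
    using fused_sigma_inv[of "r # u" "x # z # v"] fused[of u "z # v"] snoc.prems linked_sym by simp
  also have "linked \<dots> (prd (x # (z # v) @ n # r # u))"
    by (rule linked_prd)
  \<comment> \<open>The \<open>\<tau>\<close>-arc carries \<open>x\<close> past
    \<open>z\<close>.\<close>
  also have "prd (x # (z # v) @ n # r # u) = z # x # v @ n # r # u"
    using prd_tau[of "r # u" x "z # v"] x neck snoc.prems
    by (auto simp: in_permutations_of_set_iff insert_commute)
  also have "\<dots> = sigma_inv (x # v @ n # r # u @ [z])"
    using sigma_inv_snoc[of "x # v @ n # r # u" z] by simp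
  finally show ?case
    by simp
qed

text \<open>The step from children to parent: \<open>x\<close> slides through all positions after
  \<open>r\<close>, which takes the parent's string ending in \<open>n\<close> to the one starting
  with \<open>n\<close>.\<close>

lemma fused_Cons_nxt:
  assumes neck: "x # r # b \<in> necklaces" and x: "x = nxt r"
    and fused: "\<And>u v. u @ v = b \<Longrightarrow> fused (r # u @ x # v)"
  shows "fused (x # r # b)"
proof (rule fusedI[OF neck])
  have "linked (x # r # b @ [n]) (sigma_inv (x # [] @ n # r # b))"
    using linked_slide[OF neck x fused, of b "[]"] by simp
  also have "linked \<dots> (x # [] @ n # r # b)"
    using fused_sigma_inv[of "r # b" "[x]"] fused[of b "[]"] linked_sym by simp
  also have "linked \<dots> (prd (x # [] @ n # r # b))"
    by (rule linked_prd)
  also have "prd (x # [] @ n # r # b) = n # x # r # b"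
    using prd_tau[of "r # b" x "[]"] x neck by (auto simp: in_permutations_of_set_iff)
  finally show "linked ((x # r # b) @ [n]) (n # x # r # b)"
    by simp
qed

section \<open>Descending cyclic strings\<close>

text \<open>The first \<open>k\<close> symbols are \<open>r, r - 1, ...\<close> modulo
  \<open>n - 1\<close>; raising each symbol back to \<open>r\<close> avoids subtraction.\<close>

definition descends :: "nat \<Rightarrow> nat list \<Rightarrow> bool" where
  "descends k a \<longleftrightarrow> (\<forall>i<k. (nxt ^^ i) (a ! i) = a ! 0)"

text \<open>Descending from \<open>r\<close> meets \<open>r + 1\<close> only at the last of the
  \<open>n - 1\<close> symbols, so a shorter run ends before \<open>nxt r\<close>.\<close>

lemma descends_insert:
  assumes neck: "r # u @ nxt r # v \<in> necklaces" and k: "k < n - 1"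
    and desc: "descends k (r # u @ nxt r # v)"
  shows "k \<le> length u + 1"
proof (rule ccontr)
  assume less: "\<not> k \<le> length u + 1"
  then have "(nxt ^^ (length u + 1)) (nxt r) = r"
    using desc unfolding descends_def by (auto dest!: spec[of _ "length u + 1"])
  then have "(nxt ^^ (length u + 2)) r = r"
    by (simp add: funpow_swap1)
  moreover have "r \<in> {1..<n}"
    using neck by (auto simp: in_permutations_of_set_iff)
  ultimately show False
    using funpow_nxt_neq[of r "length u + 2"] less k by simp
qed

text \<open>Induction from the leaves: if the run of \<open>a\<close> breaks off within
  \<open>k + 1\<close> symbols, the run of each child breaks off within \<open>k\<close>.\<close>

lemma fused_if_not_descends:
  assumes "k \<le> n - 1" "a \<in> necklaces" "\<not> descends k a"
  shows "fused a"
  using assms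
proof (induction k arbitrary: a)
  case 0
  then show ?case
    by (simp add: descends_def)
next
  case (Suc k)
  show ?case
  proof (cases "descends k a")
    case False
    then show ?thesis
      using Suc.IH[of a] Suc.prems by simp
  next
    case True
    then have fail: "(nxt ^^ k) (a ! k) \<noteq> a ! 0"
      using Suc.prems(3) unfolding descends_def by (metis less_Suc_eq)
    obtain x r b where a: "a = x # r # b"
      using length_necklace[OF Suc.prems(2)] n_ge_3
      by (cases a rule: tau.cases) fastforce+
    show ?thesis
    proof (cases "x = nxt r")
      case False
      \<comment> \<open>A leaf: no \<open>\<tau>\<close>-arc interferes, and \<open>prd\<close>
        takes \<open>a @ [n]\<close> directly to \<open>n # a\<close>.\<close>
      have "linked (a @ [n]) (n # a)"
        using prd_sigma_inv_last[of x r b] linked_prd[of "a @ [n]"] Suc.prems(2) a False by simp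
      then show ?thesis
        by (rule fusedI[OF Suc.prems(2)])
    next
      case True
      have "fused (r # u @ x # v)" if uv: "u @ v = b" for u v
      proof (rule Suc.IH)
        show neck: "r # u @ x # v \<in> necklaces"
          using Suc.prems(2) unfolding a
          by (auto simp: in_permutations_of_set_iff insert_commute simp flip: uv)
        show "\<not> descends k (r # u @ x # v)"
        proof
          assume desc: "descends k (r # u @ x # v)"
          \<comment> \<open>As \<open>x\<close> lies beyond the child's run, that run prefixed by
            \<open>x\<close> would be a run of \<open>k + 1\<close> symbols in
            \<open>a\<close>.\<close>
          have le: "k \<le> length u + 1"
            using descends_insert[of r u v k] neck desc True Suc.prems(1) by simp
          obtain j where j: "k = Suc j"
            using fail by (cases k) auto
          have "(r # u @ x # v) ! j = (r # b) ! j"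
            using le j by (cases j) (simp_all add: nth_append flip: uv)
          moreover have "(nxt ^^ j) ((r # u @ x # v) ! j) = r"
            using desc j unfolding descends_def by (metis lessI nth_Cons_0)
          ultimately have "(nxt ^^ j) (a ! k) = r"
            by (simp add: a j)
          then show False
            using fail by (simp add: a j True)
        qed
      qed (use Suc.prems(1) in simp)
      moreover have "x # r # b \<in> necklaces"
        using Suc.prems(2) a by simp
      ultimately have "fused (x # r # b)"
        using True by (intro fused_Cons_nxt)
      then show ?thesis
        by (simp only: a)
    qed
  qed
qed

text \<open>Since \<open>nxt\<close> has period \<open>n - 1\<close>, this is the word \<open>r, r - 1, \<dots>, r + 1\<close> modulo \<open>n - 1\<close>.\<close>

definition tower :: "nat \<Rightarrow> nat list" where
  "tower r = map (\<lambda>i. (nxt ^^ i) r) (rev [1..<n])"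

text \<open>The part common to \<open>tower r\<close> and \<open>tower (nxt r)\<close>: these differ
  only in whether \<open>nxt r\<close> stands last or first.\<close>

definition tower_mid :: "nat \<Rightarrow> nat list" where
  "tower_mid r = map (\<lambda>i. (nxt ^^ i) r) (rev [2..<n - 1])"

lemma tower_eq:
  assumes "r \<in> {1..<n}"
  shows "tower r = r # tower_mid r @ [nxt r]"
proof -
  have "[1..<n] = 1 # [2..<n - 1] @ [n - 1]"
    using n_ge_3 upt_Suc_append[of 2 "n - 1"] upt_conv_Cons[of 1 n]
    by (simp add: numeral_2_eq_2)
  then show ?thesis
    using funpow_nxt_period[OF assms] by (simp add: tower_def tower_mid_def)
qed

text \<open>Thus \<open>tower (nxt r)\<close> is the parent of \<open>tower r\<close>, which closes
  the chain of towers.\<close>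

lemma tower_nxt:
  assumes "r \<in> {1..<n}"
  shows "tower (nxt r) = nxt r # r # tower_mid r"
proof -
  have "tower (nxt r) = map (\<lambda>i. (nxt ^^ i) r) (rev (map Suc [1..<n]))"
    unfolding tower_def rev_map map_map by (simp add: o_def funpow_swap1)
  also have "map Suc [1..<n] = [2..<n - 1] @ [n - 1, n]"
    using n_ge_3 upt_Suc_append[of 2 "n - 1"] upt_Suc_append[of 2 n]
    by (simp add: map_Suc_upt numeral_2_eq_2)
  finally have "tower (nxt r) = (nxt ^^ n) r # (nxt ^^ (n - 1)) r # tower_mid r"
    by (simp add: tower_mid_def)
  moreover have "(nxt ^^ n) r = nxt ((nxt ^^ (n - 1)) r)"
    using n_ge_3 by (cases n) auto
  ultimately show ?thesis
    using funpow_nxt_period[OF assms] by simp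
qed

lemma tower_necklace:
  assumes r: "r \<in> {1..<n}"
  shows "tower r \<in> necklaces"
proof -
  have neq: "(nxt ^^ i) r \<noteq> (nxt ^^ j) r" if "i < j" "j - i < n - 1" for i j
  proof -
    have "(nxt ^^ j) r = (nxt ^^ (j - i)) ((nxt ^^ i) r)"
      using that(1) by (simp add: funpow_funpow)
    then show ?thesis
      using funpow_nxt_neq[OF funpow_nxt_in[OF r, of i], of "j - i"] that by auto
  qed
  have "inj_on (\<lambda>i. (nxt ^^ i) r) {1..<n}"
  proof (rule inj_onI)
    fix i j assume ij: "i \<in> {1..<n}" "j \<in> {1..<n}" "(nxt ^^ i) r = (nxt ^^ j) r"
    then have "j - i < n - 1" "i - j < n - 1"
      by auto
    then show "i = j"
      using neq[of i j] neq[of j i] ij(3) by (metis linorder_neqE_nat)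
  qed
  then have "distinct (tower r)"
    by (simp add: tower_def distinct_map)
  moreover have "set (tower r) \<subseteq> {1..<n}"
    using funpow_nxt_in[OF r] by (auto simp: tower_def)
  moreover have "length (tower r) = n - 1"
    by (simp add: tower_def)
  ultimately show ?thesis
    unfolding in_permutations_of_set_iff
    by (metis card_atLeastLessThan card_subset_eq distinct_card finite_atLeastLessThan)
qed

text \<open>Applying \<open>nxt\<close> another \<open>n - 1 - i\<close> times to
  \<open>(nxt ^^ i) (a ! i) = a ! 0\<close> completes a period and recovers
  \<open>a ! i\<close>.\<close>

lemma descends_full:
  assumes a: "a \<in> necklaces" and desc: "descends (n - 1) a"
  shows "a = tower (a ! 0)"
proof (rule nth_equalityI)
  show "length a = length (tower (a ! 0))"
    using length_necklace[OF a] by (simp add: tower_def)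
  fix i assume i: "i < length a"
  then have less: "i < n - 1"
    using length_necklace[OF a] by simp
  have "tower (a ! 0) ! i = (nxt ^^ (n - 1 - i)) (a ! 0)"
  proof -
    have "n - 1 - i = Suc (n - 1 - Suc i)"
      using less by simp
    then show ?thesis
      using less by (simp add: tower_def rev_nth)
  qed
  also have "\<dots> = (nxt ^^ (n - 1 - i)) ((nxt ^^ i) (a ! i))"
    using desc less by (simp add: descends_def)
  also have "\<dots> = (nxt ^^ (n - 1)) (a ! i)"
    using less by (simp add: funpow_funpow)
  also have "\<dots> = a ! i"
    using a i nth_mem by (intro funpow_nxt_period) (auto simp: in_permutations_of_set_iff)
  finally show "a ! i = tower (a ! 0) ! i"
    by simp
qed


section \<open>The outer side of the closed chain\<close>

text \<open>A tower starting with \<open>r\<close> ends with \<open>nxt r\<close>, so an insertion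
  before the end is no tower. Hence \<open>linked_slide\<close> applies even when
  \<open>x # r # b\<close> is itself a tower.\<close>

lemma fused_insert:
  assumes neck: "x # r # b \<in> necklaces" and x: "x = nxt r"
    and uv: "u @ v = b" "v \<noteq> []"
  shows "fused (r # u @ x # v)"
proof (rule fused_if_not_descends[OF order_refl])
  show neck1: "r # u @ x # v \<in> necklaces"
    using neck by (auto simp: in_permutations_of_set_iff insert_commute simp flip: uv(1))
  show "\<not> descends (n - 1) (r # u @ x # v)"
  proof
    assume "descends (n - 1) (r # u @ x # v)"
    then have "r # u @ x # v = tower r"
      using descends_full[OF neck1] by simp
    moreover have "r \<in> {1..<n}"
      using neck by (auto simp: in_permutations_of_set_iff)
    ultimately have "last (r # u @ x # v) = x"
      using tower_eq by (simp add: x)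
    then have "x \<in> set v"
      using uv(2) last_in_set[of v] by simp
    then show False
      using neck1 by (auto simp: in_permutations_of_set_iff)
  qed
qed

text \<open>Passing to the parent lengthens the descending run, so after finitely many steps a tower
  is reached, and always at its string ending in \<open>n\<close>.\<close>

lemma linked_tower:
  assumes "k > 0" "a \<in> necklaces" "descends k a" "\<not> descends (n - 1) a"
  shows "\<exists>x \<in> {1..<n}. linked (n # a) (tower x @ [n])"
  using assms
proof (induction "n - 1 - k" arbitrary: k a rule: less_induct)
  case less
  define r where "r = a ! 0"
  define x where "x = nxt r"
  have k: "k < n - 1"
    using less.prems(3,4) unfolding descends_def by (meson not_less order.strict_trans2)
  have len: "length a = n - 1"
    using less.prems(2) by (rule length_necklace)
  have "r \<in> set a"
    using len n_ge_3 by (simp add: r_def)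
  then have r: "r \<in> {1..<n}"
    using less.prems(2) by (auto simp: in_permutations_of_set_iff)
  have "x \<in> set a"
    using less.prems(2) nxt_in by (simp add: in_permutations_of_set_iff x_def)
  then obtain u' v where "a = u' @ x # v"
    by (meson split_list)
  moreover from this have "u' \<noteq> []"
    using nxt_neq[OF r] by (metis append_Nil nth_Cons_0 r_def x_def)
  ultimately obtain u where a: "a = r # u @ x # v"
    by (cases u') (auto simp: r_def)
  have le: "k \<le> length u + 1"
    using descends_insert[of r u v k] less.prems k a by (simp add: x_def)
  have neck: "x # r # u @ v \<in> necklaces"
    using less.prems(2) a by (auto simp: in_permutations_of_set_iff insert_commute)
  \<comment> \<open>Sliding \<open>x\<close> from the front of the parent to its place in
    \<open>a\<close> connects the two.\<close>
  have "linked (x # r # (u @ v) @ [n]) (sigma_inv (x # v @ n # r # u))"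
    using linked_slide[OF neck x_def fused_insert[OF neck x_def]] by blast
  moreover have "fused a"
    using fused_if_not_descends[OF order_refl] less.prems by blast
  then have "linked (n # a) (x # v @ n # r # u)" "linked (x # v @ n # r # u) (sigma_inv (x # v @ n # r # u))"
    using fusedD[of "r # u" "x # v"] fused_sigma_inv[of "r # u" "x # v"] a linked_sym by auto
  ultimately have step: "linked (n # a) (x # r # (u @ v) @ [n])"
    using linked_sym linked_trans by blast
  let ?a = "x # r # u @ v"
  show ?case
  proof (cases "descends (n - 1) ?a")
    case True
    then have "tower x = ?a"
      using descends_full[OF neck] by simp
    then have "linked (n # a) (tower x @ [n])"
      using step by simp
    then show ?thesis
      using nxt_in[of r] unfolding x_def by blast
  next
    case False
    have "descends (Suc k) ?a"
      unfolding descends_def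
    proof (intro allI impI)
      fix i assume i: "i < Suc k"
      show "(nxt ^^ i) (?a ! i) = ?a ! 0"
      proof (cases i)
        case (Suc j)
        then have "?a ! i = a ! j" "j < k"
          using i le a by (auto simp: nth_Cons nth_append split: nat.split)
        then have "(nxt ^^ j) (?a ! i) = r"
          using less.prems(3) by (simp add: descends_def r_def)
        then show ?thesis
          using Suc by (simp add: x_def)
      qed simp
    qed
    moreover have "n - 1 - Suc k < n - 1 - k"
      using k by simp
    ultimately obtain y where y: "y \<in> {1..<n}" "linked (n # ?a) (tower y @ [n])"
      using less.hyps[of "Suc k" ?a] neck False by blast
    \<comment> \<open>The parent is fused as well, so the path continues from its string starting
      with \<open>n\<close>.\<close>
    have "linked (x # r # (u @ v) @ [n]) (n # ?a)"
      using fusedD[of "[]" ?a] fused_if_not_descends[OF order_refl neck False] by simp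
    then have "linked (n # a) (tower y @ [n])"
      using step y(2) by (simp add: linked_def)
    then show ?thesis
      using y(1) by blast
  qed
qed

text \<open>Sliding \<open>nxt r\<close> to the end and then rotating reaches all strings on the
  cyclic string of \<open>tower r\<close> except two, \<open>n # tower r\<close> and
  \<open>nxt r # n # r # tower_mid r\<close>.\<close>

lemma linked_tower_long:
  assumes r: "r \<in> {1..<n}" and "u @ v = r # tower_mid r" "v \<noteq> []"
  shows "linked (tower (nxt r) @ [n]) (v @ [nxt r, n] @ u)"
  using assms(2,3)
proof (induction v arbitrary: u)
  case (Cons y v)
  define x where "x = nxt r"
  have neck: "r # tower_mid r @ [x] \<in> necklaces"
    using tower_necklace[OF r] tower_eq[OF r] by (simp add: x_def)
  have neck': "x # r # tower_mid r \<in> necklaces"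
    using tower_necklace[OF nxt_in, of r] tower_nxt[OF r] by (simp add: x_def)
  show ?case
  proof (cases "v = []")
    case True
    have "linked (x # r # tower_mid r @ [n]) (sigma_inv (x # [] @ n # r # tower_mid r))"
      using linked_slide[OF neck' x_def fused_insert[OF neck' x_def], of "tower_mid r" "[]"] by simp
    moreover have "sigma_inv (x # [] @ n # r # tower_mid r) = [y] @ [x, n] @ u"
      using Cons.prems True sigma_inv_snoc[of "x # n # u" y] by (simp flip: Cons.prems(1))
    ultimately show ?thesis
      using True tower_nxt[OF r] by (simp add: x_def)
  next
    case False
    have uy: "hd (u @ [y]) = r"
      using Cons.prems(1) by (cases u) auto
    have "linked (tower (nxt r) @ [n]) (v @ [x, n] @ u @ [y])"
      using Cons.IH[of "u @ [y]"] Cons.prems False by (simp add: x_def)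
    also have "linked \<dots> (prd \<dots>)"
      by (rule linked_prd)
    also have "prd (v @ [x, n] @ u @ [y]) = sigma_inv (v @ [x, n] @ u @ [y])"
    proof -
      have eq: "(u @ [y]) @ v @ [x] = r # tower_mid r @ [x]"
        using Cons.prems(1) by (metis append_Cons append_Nil append_assoc)
      then have n1: "(u @ [y]) @ v @ [x] \<in> necklaces"
        using neck by (simp only:)
      \<comment> \<open>Rotation goes on because \<open>x\<close>, the only front symbol that
        triggers a \<open>\<tau>\<close>-arc here, is not met in \<open>v\<close>.\<close>
      then have "x \<notin> set v"
        by (auto simp: in_permutations_of_set_iff)
      then have "hd (v @ [x]) \<noteq> nxt (hd (u @ [y]))"
        using False uy by (cases v) (auto simp: x_def)
      then show ?thesis
        using prd_sigma_inv[OF n1] by simp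
    qed
    also have "\<dots> = (y # v) @ [x, n] @ u"
      using sigma_inv_snoc[of "v @ [x, n] @ u" y] by simp
    finally show ?thesis
      by (simp add: x_def)
  qed
qed simp

text \<open>For empty \<open>u\<close>, \<open>linked_tower_long\<close> ends in
  \<open>tower x @ [n]\<close>, so it joins consecutive towers of the chain.\<close>

lemma linked_tower_one:
  assumes "x \<in> {1..<n}"
  shows "linked (tower x @ [n]) (tower 1 @ [n])"
  using assms
proof (induction rule: nxt_induct)
  case (nxt x)
  have "linked (tower (nxt x) @ [n]) ((x # tower_mid x) @ [nxt x, n] @ [])"
    by (rule linked_tower_long) (use nxt in simp_all)
  then show ?case
    using nxt tower_eq[of x] by (simp add: linked_def)
qed simp

section \<open>The two cycles\<close>

text \<open>The inner side of the chain: for each tower, the two strings that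
  \<open>linked_tower_long\<close> leaves out.\<close>

definition short_cycle :: "nat list set" where
  "short_cycle = (\<Union>r \<in> {1..<n}. {n # tower r, nxt r # n # r # tower_mid r})"

text \<open>A rotation brings \<open>nxt r\<close> in front of \<open>n\<close>, and the
  \<open>\<tau>\<close>-arc then swaps the two, which gives the next tower.\<close>

lemma prd_tower:
  assumes r: "r \<in> {1..<n}"
  shows "prd (n # tower r) = nxt r # n # r # tower_mid r"
    "prd (nxt r # n # r # tower_mid r) = n # tower (nxt r)"
proof -
  have neck: "(r # tower_mid r) @ [nxt r] \<in> necklaces"
    using tower_necklace[OF r] tower_eq[OF r] by simp
  have "prd ([] @ n # tower r) = sigma_inv ([] @ n # tower r)"
    by (rule prd_sigma_inv) (use tower_necklace[OF r] tower_eq[OF r] in simp_all)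
  also have "\<dots> = nxt r # n # r # tower_mid r"
    using sigma_inv_snoc[of "n # r # tower_mid r" "nxt r"] tower_eq[OF r] by simp
  finally show "prd (n # tower r) = nxt r # n # r # tower_mid r"
    by simp
  have "prd (nxt r # [] @ n # r # tower_mid r) = tau (nxt r # [] @ n # r # tower_mid r)"
    by (rule prd_tau[OF neck]) simp
  then show "prd (nxt r # n # r # tower_mid r) = n # tower (nxt r)"
    unfolding tower_nxt[OF r] by simp
qed

lemma orbit_subset_short_cycle: "orbit prd (n # tower 1) \<subseteq> short_cycle"
proof
  have step: "prd q \<in> short_cycle" if "q \<in> short_cycle" for q
  proof -
    obtain r where r: "r \<in> {1..<n}" and q: "q = n # tower r \<or> q = nxt r # n # r # tower_mid r"
      using \<open>q \<in> short_cycle\<close> unfolding short_cycle_def by blast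
    from q have "prd q \<in> {n # tower (nxt r), nxt r # n # r # tower_mid r}"
      using prd_tower[OF r] by blast
    then show ?thesis
      using r nxt_in[of r] unfolding short_cycle_def by blast
  qed
  fix q assume "q \<in> orbit prd (n # tower 1)"
  then show "q \<in> short_cycle"
  proof induction
    \<comment> \<open>\<open>orbit\<close> is generated from the image of the starting point, not
      from the point itself.\<close>
    case base
    show ?case
      using step[of "n # tower 1"] n_ge_3 by (force simp: short_cycle_def)
  qed (rule step)
qed

lemma linked_short_cycle:
  assumes "q \<in> short_cycle"
  shows "linked q (n # tower 1)"
proof -
  obtain r where r: "r \<in> {1..<n}" and q: "q = n # tower r \<or> q = prd (n # tower r)"
    using assms prd_tower by (auto simp: short_cycle_def)
  have "linked (n # tower r) (n # tower 1)"
    using r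
  proof (induction rule: nxt_induct)
    case (nxt r)
    have "prd (prd (n # tower r)) = n # tower (nxt r)"
      using nxt prd_tower by simp
    then have "linked (n # tower r) (n # tower (nxt r))"
      using linked_prd[of "n # tower r"] linked_prd[of "prd (n # tower r)"] by (simp add: linked_def)
    then show ?case
      using nxt by (simp add: linked_def)
  qed simp
  then show ?thesis
    using q linked_prd[of "n # tower r"] by (auto simp: linked_def)
qed

lemma linked_cases:
  assumes "p \<in> perm_strings n"
  shows "p \<in> short_cycle \<or> linked p (tower 1 @ [n])"
proof -
  obtain u v where p: "p = v @ n # u" and neck: "u @ v \<in> necklaces"
    using assms by (rule perm_string_rotation)
  show ?thesis
  proof (cases "descends (n - 1) (u @ v)")
    case False
    then have "fused (u @ v)"
      using fused_if_not_descends[OF order_refl neck] by blast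
    then have "linked p (n # u @ v)"
      using fusedD p by blast
    moreover obtain x where "x \<in> {1..<n}" "linked (n # u @ v) (tower x @ [n])"
      using linked_tower[of 1 "u @ v"] neck False by (auto simp: descends_def)
    ultimately show ?thesis
      using linked_tower_one linked_trans by blast
  next
    case True
    define r where "r = (u @ v) ! 0"
    have "(u @ v) ! 0 \<in> set (u @ v)"
      using length_necklace[OF neck] n_ge_3 by (intro nth_mem) simp
    then have r: "r \<in> {1..<n}"
      using neck unfolding in_permutations_of_set_iff r_def by blast
    have uv: "u @ v = (r # tower_mid r) @ [nxt r]"
      using descends_full[OF neck True] tower_eq[OF r] by (simp add: r_def)
    \<comment> \<open>The two exceptional strings have \<open>v = []\<close> and
      \<open>v = [nxt r]\<close>; any longer \<open>v\<close> is on the outer side.\<close>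
    show ?thesis
    proof (cases v rule: rev_cases)
      case Nil
      then have "p = n # tower r"
        using p uv tower_eq[OF r] by simp
      then show ?thesis
        using r by (auto simp: short_cycle_def)
    next
      case (snoc w z)
      then have w: "u @ w = r # tower_mid r" "z = nxt r"
        using uv by (metis append_assoc append1_eq_conv)+
      show ?thesis
      proof (cases "w = []")
        case True
        then have "p = nxt r # n # r # tower_mid r"
          using p snoc w by simp
        then show ?thesis
          using r by (auto simp: short_cycle_def)
      next
        case False
        have "linked (tower (nxt r) @ [n]) p"
          using linked_tower_long[OF r w(1) False] p snoc w(2) by simp
        then show ?thesis
          using linked_tower_one[OF nxt_in] linked_sym linked_trans by blast
      qed
    qed
  qed
qed

lemma orbits_cover:
  "orbit prd (n # tower 1) \<union> orbit prd (tower 1 @ [n]) = perm_strings n"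
  "orbit prd (n # tower 1) \<inter> orbit prd (tower 1 @ [n]) = {}"
proof -
  let ?C1 = "orbit prd (n # tower 1)" and ?C2 = "orbit prd (tower 1 @ [n])"
  have one: "1 \<in> {1..<n}"
    using n_ge_3 by simp
  have self: "p \<in> orbit prd p" for p
    using prd_permutation by (rule permutation_self_in_orbit)
  have "n # tower 1 \<in> perm_strings n" "tower 1 @ [n] \<in> perm_strings n"
    using necklace_rotation[of "tower 1" "[]"] necklace_rotation[of "[]" "tower 1"]
      tower_necklace[OF one] by simp_all
  then have "?C1 \<union> ?C2 \<subseteq> perm_strings n"
    using permutes_orbit_subset[OF prd_permutes] by blast
  moreover have "p \<in> ?C1 \<union> ?C2" if "p \<in> perm_strings n" for p
    using linked_cases[OF that] linked_short_cycle[of p] self[of p] by (auto simp: linked_def)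
  ultimately show "?C1 \<union> ?C2 = perm_strings n"
    by blast
  have "tower 1 @ [n] \<notin> short_cycle"
  proof
    assume "tower 1 @ [n] \<in> short_cycle"
    then obtain r where "r \<in> {1..<n}"
      "tower 1 @ [n] = n # tower r \<or> tower 1 @ [n] = nxt r # n # r # tower_mid r"
      by (auto simp: short_cycle_def)
    \<comment> \<open>A tower has at least two symbols, so an \<open>n\<close> in first or second
      position of \<open>tower 1 @ [n]\<close> would belong to the tower.\<close>
    then have "n \<in> set (tower 1)"
      using tower_eq[OF one] by (cases "tower_mid 1") (auto simp: tower_eq)
    then show False
      using tower_necklace[OF one] by (auto simp: in_permutations_of_set_iff)
  qed
  then have "tower 1 @ [n] \<notin> ?C1"
    using orbit_subset_short_cycle by blast
  show "?C1 \<inter> ?C2 = {}"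
  proof (rule ccontr)
    assume "?C1 \<inter> ?C2 \<noteq> {}"
    then obtain q where "q \<in> ?C1" "q \<in> ?C2"
      by blast
    then have "?C1 = ?C2"
      using orbit_cyclic_eq3[OF cyclic_on_orbit'[OF prd_permutation]] by metis
    then show False
      using self[of "tower 1 @ [n]"] \<open>tower 1 @ [n] \<notin> ?C1\<close> by simp
  qed
qed

lemma cycle_of_prd_orbit:
  assumes "p \<in> perm_strings n"
  obtains c where "pre_digraph.cycle (with_proj (sigma_tau_graph n)) c"
    "cycle_verts c = orbit prd p" "set c = {(prd q, q) | q. q \<in> orbit prd p}"
proof -
  have sub: "orbit prd p \<subseteq> perm_strings n"
    using assms permutes_orbit_subset[OF prd_permutes] by blast
  have verts: "orbit prd p \<subseteq> pverts (sigma_tau_graph n)"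
    using sub by (simp add: sigma_tau_graph_def)
  have arcs: "(prd q, q) \<in> parcs (sigma_tau_graph n)" if "q \<in> orbit prd p" for q
    using that sub D_subset D_eq by blast
  obtain c where c: "pre_digraph.cycle (with_proj (sigma_tau_graph n)) c"
    "set c = {(prd q, q) | q. q \<in> orbit prd p}"
    by (rule cycle_of_orbit[OF prd_permutation verts arcs])
  \<comment> \<open>\<open>cycle_verts\<close> collects the tails \<open>prd q\<close>; they exhaust
    the orbit because \<open>prd\<close> maps it onto itself.\<close>
  have "prd ` orbit prd p = orbit prd p"
    using orbit_inverse[of p prd prd prd] permutation_self_in_orbit[OF prd_permutation]
      permutation_orbit_step[OF prd_permutation] by simp
  moreover have "cycle_verts c = prd ` orbit prd p"
    unfolding cycle_verts_def c(2) by force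
  ultimately show ?thesis
    using that c by simp
qed

lemma two_cycles:
  "\<exists>c1 c2. pre_digraph.cycle (with_proj (sigma_tau_graph n)) c1 \<and>
     pre_digraph.cycle (with_proj (sigma_tau_graph n)) c2 \<and>
     cycle_verts c1 \<inter> cycle_verts c2 = {} \<and>
     cycle_verts c1 \<union> cycle_verts c2 = perm_strings n \<and>
     D n = set c1 \<union> set c2"
proof -
  let ?p = "n # tower 1" and ?q = "tower 1 @ [n]"
  have p: "?p \<in> perm_strings n" and q: "?q \<in> perm_strings n"
    using orbits_cover(1) permutation_self_in_orbit[OF prd_permutation] by blast+
  obtain c1 where c1: "pre_digraph.cycle (with_proj (sigma_tau_graph n)) c1"
    "cycle_verts c1 = orbit prd ?p" "set c1 = {(prd p, p) | p. p \<in> orbit prd ?p}"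
    by (rule cycle_of_prd_orbit[OF p])
  obtain c2 where c2: "pre_digraph.cycle (with_proj (sigma_tau_graph n)) c2"
    "cycle_verts c2 = orbit prd ?q" "set c2 = {(prd p, p) | p. p \<in> orbit prd ?q}"
    by (rule cycle_of_prd_orbit[OF q])
  have "D n = set c1 \<union> set c2"
    unfolding D_eq orbits_cover(1)[symmetric] c1 c2 by blast
  then show ?thesis
    using c1(1,2) c2(1,2) orbits_cover by (intro exI[of _ c1] exI[of _ c2]) simp
qed

end

theorem theorem18:
  fixes n :: nat
  assumes "n \<ge> 3"
  shows "D n \<subseteq> parcs (sigma_tau_graph n) \<and>
    (\<forall>v \<in> pverts (sigma_tau_graph n).
       (\<exists>!a. a \<in> D n \<and> snd a = v) \<and> (\<exists>!a. a \<in> D n \<and> fst a = v)) \<and>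
    (\<exists>c1 c2.
       pre_digraph.cycle (with_proj (sigma_tau_graph n)) c1 \<and>
       pre_digraph.cycle (with_proj (sigma_tau_graph n)) c2 \<and>
       cycle_verts c1 \<inter> cycle_verts c2 = {} \<and>
       cycle_verts c1 \<union> cycle_verts c2 = pverts (sigma_tau_graph n) \<and>
       D n = set c1 \<union> set c2)"
proof -
  interpret sigma_tau n
    using assms by unfold_locales
  have "pverts (sigma_tau_graph n) = perm_strings n"
    by (simp add: sigma_tau_graph_def)
  then show ?thesis
    using D_subset D_cover two_cycles by simp
qed

end
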